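(* The zero forcing number of the generalized Petersen graph $P(12,3)$ is $Z(P(12,3)) = 7$. In particular, the assertion "$Z(P(n,3)) = 8$ for all $n \ge 12$" is false at $n = 12$.
   Context: Let $G=(V,E)$ be a finite simple graph. Color a subset $S\subseteq V$ black and the remaining vertices white. Color change rule: a black vertex with exactly one white neighbor forces that neighbor to become black. Iterating this rule starting from $S$ until no further force is possible gives the closure $\mathrm{cl}(S)$. The set $S$ is a zero forcing set of $G$ if $\mathrm{cl}(S)=V$, and the zero forcing number $Z(G)$ is the minimum cardinality of a zero forcing set. For $n\ge 3$ and $1\le k<n/2$, the generalized Petersen graph $P(n,k)$ has the $2n$ vertices $\{u_0,\dots,u_{n-1}\}\cup\{v_0,\dots,v_{n-1}\}$ and edges $u_i\sim u_{i+1}$, $u_i\sim v_i$, and $v_i\sim v_{i+k}$ for all $i$, with indices taken modulo $n$. *)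

theory Defs
  imports "Graph_Theory.Pair_Digraph"
begin

text \<open>
  Finite simple graphs are the graphs of locale \<^locale>\<open>pair_graph\<close>: finitely many vertices
  and a symmetric, loop-free adjacency relation, so that each undirected edge is represented by
  its two opposite arcs. A colouring is given by its set \<^term>\<open>B\<close> of black vertices.
\<close>

definition white_neighbors :: "'a pair_pre_digraph \<Rightarrow> 'a set \<Rightarrow> 'a \<Rightarrow> 'a set" where
  "white_neighbors G B b = {w \<in> pverts G - B. (b, w) \<in> parcs G}"

definition force_step :: "'a pair_pre_digraph \<Rightarrow> 'a set \<Rightarrow> 'a set \<Rightarrow> bool" where
  "force_step G B B' \<longleftrightarrow> (\<exists>b\<in>B. \<exists>w. white_neighbors G B b = {w} \<and> B' = insert w B)"

definition final_coloring :: "'a pair_pre_digraph \<Rightarrow> 'a set \<Rightarrow> 'a set \<Rightarrow> bool" where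
  "final_coloring G S T \<longleftrightarrow> (force_step G)\<^sup>*\<^sup>* S T \<and> (\<nexists>T'. force_step G T T')"

text \<open>
  The definite description is justified by \<open>ex1_final_coloring\<close> below: forcing
  terminates, and its result does not depend on the order of the forces.
\<close>

definition zf_closure :: "'a pair_pre_digraph \<Rightarrow> 'a set \<Rightarrow> 'a set" where
  "zf_closure G S = (THE T. final_coloring G S T)"

definition zero_forcing_set :: "'a pair_pre_digraph \<Rightarrow> 'a set \<Rightarrow> bool" where
  "zero_forcing_set G S \<longleftrightarrow> S \<subseteq> pverts G \<and> zf_closure G S = pverts G"

definition zero_forcing_number :: "'a pair_pre_digraph \<Rightarrow> nat" where
  "zero_forcing_number G = Min (card ` {S. zero_forcing_set G S})"

lemma final_coloring_exists:
  assumes "finite (pverts G)"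
  shows "\<exists>T. final_coloring G S T"
proof (induction "card (pverts G - S)" arbitrary: S rule: less_induct)
  case less
  show ?case
  proof (cases "\<exists>S'. force_step G S S'")
    case True
    then obtain b w where w: "white_neighbors G S b = {w}" "force_step G S (insert w S)"
      unfolding force_step_def by blast
    then have "w \<in> pverts G - S"
      unfolding white_neighbors_def by blast
    then have "pverts G - insert w S \<subset> pverts G - S"
      by blast
    then have "card (pverts G - insert w S) < card (pverts G - S)"
      using assms by (intro psubset_card_mono) auto
    then obtain T where "final_coloring G (insert w S) T"
      using less by blast
    then have "final_coloring G S T"
      using w(2) unfolding final_coloring_def by (meson converse_rtranclp_into_rtranclp)
    then show ?thesis by blast
  next
    case False
    then have "final_coloring G S S"
      unfolding final_coloring_def by blast
    then show ?thesis by blast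
  qed
qed

lemma reachable_subset_final:
  assumes "(force_step G)\<^sup>*\<^sup>* S T" "final_coloring G S T'"
  shows "T \<subseteq> T'"
  using assms(1)
proof induction
  case base
  have "(force_step G)\<^sup>*\<^sup>* S T'"
    using assms(2) unfolding final_coloring_def by blast
  then show ?case
    by induction (auto simp: force_step_def)
next
  case (step B C)
  then obtain b w where b: "b \<in> B" "white_neighbors G B b = {w}" "C = insert w B"
    unfolding force_step_def by blast
  have "w \<in> T'"
  proof (rule ccontr)
    assume "w \<notin> T'"
    then have "white_neighbors G T' b = {w}"
      using b(2) step.IH unfolding white_neighbors_def by blast
    then have "force_step G T' (insert w T')"
      using b(1) step.IH unfolding force_step_def by blast
    then show False
      using assms(2) unfolding final_coloring_def by blast
  qed
  then show ?case
    using b(3) step.IH by blast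
qed

lemma ex1_final_coloring:
  assumes "finite (pverts G)"
  shows "\<exists>!T. final_coloring G S T"
proof -
  have "T = T'" if "final_coloring G S T" "final_coloring G S T'" for T T'
    using that reachable_subset_final[of G S] unfolding final_coloring_def
    by (meson subset_antisym)
  then show ?thesis
    using final_coloring_exists[OF assms] by blast
qed

lemma zero_forcing_set_pverts:
  assumes "finite (pverts G)"
  shows "zero_forcing_set G (pverts G)"
proof -
  have "final_coloring G (pverts G) (pverts G)"
    unfolding final_coloring_def force_step_def white_neighbors_def by auto
  then have "zf_closure G (pverts G) = pverts G"
    unfolding zf_closure_def using ex1_final_coloring[OF assms] by (rule the1_equality[rotated])
  then show ?thesis
    unfolding zero_forcing_set_def by simp
qed

lemma finite_zero_forcing_sets:
  assumes "finite (pverts G)"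
  shows "finite {S. zero_forcing_set G S}"
  using assms by (rule finite_subset[rotated, OF finite_Pow_iff[THEN iffD2]])
    (auto simp: zero_forcing_set_def)

text \<open>The vertices \<open>u\<^sub>i\<close> are \<open>Outer i\<close>, and the vertices \<open>v\<^sub>i\<close> are \<open>Inner i\<close>.\<close>

datatype gp_vertex = Outer nat | Inner nat

definition gp_arcs :: "nat \<Rightarrow> nat \<Rightarrow> gp_vertex rel" where
  "gp_arcs n k =
     (\<lambda>i. (Outer i, Outer ((i + 1) mod n))) ` {..<n} \<union>
     (\<lambda>i. (Outer i, Inner i)) ` {..<n} \<union>
     (\<lambda>i. (Inner i, Inner ((i + k) mod n))) ` {..<n}"

definition gen_petersen :: "nat \<Rightarrow> nat \<Rightarrow> gp_vertex pair_pre_digraph" where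
  "gen_petersen n k =
     \<lparr> pverts = Outer ` {..<n} \<union> Inner ` {..<n},
       parcs = gp_arcs n k \<union> (gp_arcs n k)\<inverse> \<rparr>"

lemma add_mod_neq:
  fixes i k n :: nat
  assumes "i < n" "0 < k" "k < n"
  shows "(i + k) mod n \<noteq> i"
proof (cases "i + k < n")
  case False
  then have "(i + k) mod n = i + k - n"
    using assms by (simp add: mod_if)
  then show ?thesis using assms False by linarith
qed (use assms in simp)

lemma pair_graph_gen_petersen:
  assumes "3 \<le> n" "1 \<le> k" "2 * k < n"
  shows "pair_graph (gen_petersen n k)"
proof -
  have loopfree: "a \<noteq> b" if "(a, b) \<in> gp_arcs n k" for a b
    using that add_mod_neq[of _ n k] add_mod_neq[of _ n 1] assms
    by (fastforce simp: gp_arcs_def)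
  have verts: "a \<in> pverts (gen_petersen n k) \<and> b \<in> pverts (gen_petersen n k)"
    if "(a, b) \<in> gp_arcs n k" for a b
    using that assms by (auto simp: gp_arcs_def gen_petersen_def)
  have fin: "finite (gp_arcs n k)"
    by (simp add: gp_arcs_def)
  have arcs: "(a, b) \<in> parcs (gen_petersen n k) \<longleftrightarrow> (a, b) \<in> gp_arcs n k \<or> (b, a) \<in> gp_arcs n k"
    for a b by (auto simp: gen_petersen_def)
  show ?thesis
  proof
    show "finite (pverts (gen_petersen n k))" "finite (parcs (gen_petersen n k))"
      using fin by (simp_all add: gen_petersen_def)
    show "symmetric (with_proj (gen_petersen n k))"
      unfolding symmetric_def by (auto intro!: symI simp: arcs)
    show "fst e \<in> pverts (gen_petersen n k)" "snd e \<in> pverts (gen_petersen n k)"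
      "fst e \<noteq> snd e" if "e \<in> parcs (gen_petersen n k)" for e
      using that arcs[of "fst e" "snd e"] verts loopfree by (metis prod.collapse)+
  qed
qed

end

theory Submission
  imports Defs "HOL-Library.Code_Binary_Nat"
begin

text \<open>
  A fort is a nonempty vertex set \<open>F\<close> such that no vertex outside \<open>F\<close> has exactly one neighbour
  in \<open>F\<close>; forcing never enters a fort from outside, so a zero forcing set meets every fort.
  In \<open>P(12,3)\<close>, let \<open>S\<close> be a zero forcing set with at most 6 vertices and let \<open>b\<close> perform the
  first force. As the graph is cubic, \<open>S\<close> contains \<open>b\<close> and two of its neighbours, hence at most 3
  vertices outside the closed neighbourhood of \<open>b\<close>, and these must meet every fort disjoint from
  that neighbourhood. Up to rotation \<open>b\<close> is \<open>u\<^sub>0\<close> or \<open>v\<^sub>0\<close>, and for both an explicit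
  short list of forts has no transversal of size 3. The seven vertices \<open>u\<^sub>0, \<dots>, u\<^sub>6\<close> do force.
\<close>

section \<open>Forts\<close>

definition fort :: "'a pair_pre_digraph \<Rightarrow> 'a set \<Rightarrow> bool" where
  "fort G F \<longleftrightarrow> F \<noteq> {} \<and> F \<subseteq> pverts G \<and>
     (\<forall>b\<in>pverts G - F. \<forall>x\<in>F. (b, x) \<in> parcs G \<longrightarrow> (\<exists>y\<in>F. y \<noteq> x \<and> (b, y) \<in> parcs G))"

text \<open>As long as \<open>F\<close> is entirely white, a black vertex with a neighbour in
  \<open>F\<close> has a second one there. It thus sees two white vertices and cannot force into
  \<open>F\<close>.\<close>

lemma reachable_avoids_fort:
  assumes "(force_step G)\<^sup>*\<^sup>* S T" "fort G F" "S \<subseteq> pverts G" "S \<inter> F = {}"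
  shows "T \<subseteq> pverts G - F"
  using assms(1)
proof induction
  case base
  then show ?case using assms by blast
next
  case (step B C)
  then obtain b w where b: "b \<in> B" "white_neighbors G B b = {w}" "C = insert w B"
    unfolding force_step_def by blast
  then have w: "w \<in> pverts G" "(b, w) \<in> parcs G"
    unfolding white_neighbors_def by blast+
  have "w \<notin> F"
  proof
    assume "w \<in> F"
    then obtain y where y: "y \<in> F" "y \<noteq> w" "(b, y) \<in> parcs G"
      using assms(2) b(1) w step.IH unfolding fort_def by blast
    then have "y \<in> white_neighbors G B b"
      using step.IH assms(2) unfolding white_neighbors_def fort_def by blast
    then show False using b(2) y(2) by blast
  qed
  then show ?case using step.IH b(3) w(1) by blast
qed

lemma final_coloring_zf_closure:
  assumes "finite (pverts G)"
  shows "final_coloring G S (zf_closure G S)"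
  unfolding zf_closure_def using ex1_final_coloring[OF assms] by (rule theI')

lemma zero_forcing_set_meets_fort:
  assumes "finite (pverts G)" "zero_forcing_set G S" "fort G F"
  shows "S \<inter> F \<noteq> {}"
proof
  assume "S \<inter> F = {}"
  moreover have "(force_step G)\<^sup>*\<^sup>* S (pverts G)" "S \<subseteq> pverts G"
    using final_coloring_zf_closure[OF assms(1), of S] assms(2)
    unfolding zero_forcing_set_def final_coloring_def by auto
  ultimately have "pverts G \<subseteq> pverts G - F"
    using reachable_avoids_fort assms(3) by blast
  then show False using assms(3) unfolding fort_def by blast
qed

lemma zero_forcing_set_first_force:
  assumes "finite (pverts G)" "zero_forcing_set G S" "S \<noteq> pverts G"
  obtains b w where "b \<in> S" "white_neighbors G S b = {w}"
proof -
  have "(force_step G)\<^sup>*\<^sup>* S (pverts G)"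
    using final_coloring_zf_closure[OF assms(1), of S] assms(2)
    unfolding zero_forcing_set_def final_coloring_def by auto
  then obtain S' where "force_step G S S'"
    using assms(3) by (meson converse_rtranclpE)
  then show thesis using that unfolding force_step_def by blast
qed

text \<open>The fort condition depends only on adjacency. An offending pair is pulled back along the
  automorphism, the second neighbour found there is pushed forward, and injectivity keeps it
  distinct from \<open>x\<close>. This lets one list of forts serve a whole rotation orbit.\<close>

lemma fort_image:
  assumes "fort G F" "bij_betw \<phi> (pverts G) (pverts G)"
    and "\<And>a b. a \<in> pverts G \<Longrightarrow> b \<in> pverts G \<Longrightarrow> (\<phi> a, \<phi> b) \<in> parcs G \<longleftrightarrow> (a, b) \<in> parcs G"
  shows "fort G (\<phi> ` F)"
proof -
  have F: "F \<noteq> {}" "F \<subseteq> pverts G"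
    using assms(1) unfolding fort_def by auto
  have inj: "inj_on \<phi> (pverts G)" and img: "\<phi> ` pverts G = pverts G"
    using assms(2) unfolding bij_betw_def by auto
  have "\<exists>y\<in>\<phi> ` F. y \<noteq> x \<and> (b, y) \<in> parcs G"
    if b: "b \<in> pverts G - \<phi> ` F" and x: "x \<in> \<phi> ` F" and bx: "(b, x) \<in> parcs G" for b x
  proof -
    obtain b' where b': "b' \<in> pverts G - F" "b = \<phi> b'"
      using b img by blast
    obtain x' where x': "x' \<in> F" "x = \<phi> x'"
      using x by blast
    have "(b', x') \<in> parcs G"
      using assms(3) bx b' x' F(2) by blast
    then obtain y' where y': "y' \<in> F" "y' \<noteq> x'" "(b', y') \<in> parcs G"
      using assms(1) b'(1) x'(1) unfolding fort_def by blast
    then have "\<phi> y' \<noteq> x" "(b, \<phi> y') \<in> parcs G"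
      using assms(3) b' x' F(2) inj by (auto dest: inj_onD)
    then show ?thesis using y'(1) by blast
  qed
  then show ?thesis using F img unfolding fort_def by blast
qed

section \<open>Search for transversals of bounded size\<close>

fun hittable :: "nat \<Rightarrow> 'a list list \<Rightarrow> bool" where
  "hittable k [] = True"
| "hittable 0 (F # Fs) = False"
| "hittable (Suc k) (F # Fs) = list_ex (\<lambda>x. hittable k (filter (\<lambda>F'. \<not> List.member F' x) Fs)) F"

text \<open>A transversal must contain some \<open>x\<close> of the first list, and its other
  elements must hit every list that avoids \<open>x\<close>, so the branching search follows it
  down. A failed search therefore rules out transversals with at most \<open>k\<close>
  elements.\<close>

lemma hittable_complete:
  assumes "finite T" "card T \<le> k" "\<And>F. F \<in> set Fs \<Longrightarrow> T \<inter> set F \<noteq> {}"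
  shows "hittable k Fs"
  using assms
proof (induction k Fs arbitrary: T rule: hittable.induct)
  case (3 k F Fs)
  then have "T \<inter> set F \<noteq> {}" by simp
  then obtain x where x: "x \<in> T" "x \<in> set F" by blast
  have "hittable k (filter (\<lambda>F'. \<not> List.member F' x) Fs)"
  proof (rule "3.IH"[OF x(2), of "T - {x}"])
    show "finite (T - {x})" "card (T - {x}) \<le> k"
      using "3.prems"(1,2) x(1) by auto
    show "(T - {x}) \<inter> set F' \<noteq> {}" if "F' \<in> set (filter (\<lambda>F'. \<not> List.member F' x) Fs)" for F'
      using that "3.prems"(3)[of F'] by auto
  qed
  then show ?case using x(2) by (auto simp: list_ex_iff)
qed auto

section \<open>Generalized Petersen graphs\<close>

text \<open>The backward neighbours at \<open>i - 1\<close> and \<open>i - k\<close> are reached by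
  adding \<open>n - 1\<close> and \<open>n - k\<close>, which avoids truncated subtraction on
  naturals.\<close>

fun gp_nbrs :: "nat \<Rightarrow> nat \<Rightarrow> gp_vertex \<Rightarrow> gp_vertex list" where
  "gp_nbrs n k (Outer i) = [Outer ((i + 1) mod n), Outer ((i + (n - 1)) mod n), Inner i]"
| "gp_nbrs n k (Inner i) = [Inner ((i + k) mod n), Inner ((i + (n - k)) mod n), Outer i]"

text \<open>Solves for the tail of a cyclic arc, which turns the arcs coming from the converse
  relation into explicit entries of \<open>gp_nbrs\<close>.\<close>

lemma add_mod_eq_iff:
  fixes i j k n :: nat
  assumes "i < n" "j < n" "k < n"
  shows "(j + k) mod n = i \<longleftrightarrow> j = (i + (n - k)) mod n"
  using assms by (auto simp: mod_if)

lemma finite_pverts_gen_petersen: "finite (pverts (gen_petersen n k))"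
  by (simp add: gen_petersen_def)

lemma parcs_gen_petersen_iff:
  assumes "1 < n" "k < n" "a \<in> pverts (gen_petersen n k)"
  shows "(a, b) \<in> parcs (gen_petersen n k) \<longleftrightarrow> b \<in> set (gp_nbrs n k a)"
proof (cases a)
  case (Outer i)
  then have i: "i < n" using assms(3) by (auto simp: gen_petersen_def)
  have "(a, b) \<in> parcs (gen_petersen n k) \<longleftrightarrow>
      b = Outer ((i + 1) mod n) \<or> b = Inner i \<or> (\<exists>j<n. b = Outer j \<and> (j + 1) mod n = i)"
    using i by (auto simp: Outer gen_petersen_def gp_arcs_def)
  also have "\<dots> \<longleftrightarrow> b = Outer ((i + 1) mod n) \<or> b = Inner i \<or> b = Outer ((i + (n - 1)) mod n)"
    using i assms(1) add_mod_eq_iff[of i n _ 1] by (metis mod_less_divisor less_trans zero_less_one)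
  finally show ?thesis by (auto simp: Outer)
next
  case (Inner i)
  then have i: "i < n" using assms(3) by (auto simp: gen_petersen_def)
  have "(a, b) \<in> parcs (gen_petersen n k) \<longleftrightarrow>
      b = Inner ((i + k) mod n) \<or> b = Outer i \<or> (\<exists>j<n. b = Inner j \<and> (j + k) mod n = i)"
    using i by (auto simp: Inner gen_petersen_def gp_arcs_def)
  also have "\<dots> \<longleftrightarrow> b = Inner ((i + k) mod n) \<or> b = Outer i \<or> b = Inner ((i + (n - k)) mod n)"
    using i assms(1,2) add_mod_eq_iff[of i n _ k] by (metis mod_less_divisor less_trans zero_less_one)
  finally show ?thesis by (auto simp: Inner)
qed

lemma gp_nbrs_subset_pverts:
  assumes "a \<in> pverts (gen_petersen n k)"
  shows "set (gp_nbrs n k a) \<subseteq> pverts (gen_petersen n k)"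
  using assms by (cases a) (auto simp: gen_petersen_def)

section \<open>Rotational symmetry\<close>

fun gp_rot :: "nat \<Rightarrow> nat \<Rightarrow> gp_vertex \<Rightarrow> gp_vertex" where
  "gp_rot n r (Outer i) = Outer ((i + r) mod n)"
| "gp_rot n r (Inner i) = Inner ((i + r) mod n)"

lemma gp_rot_in_pverts:
  "a \<in> pverts (gen_petersen n k) \<Longrightarrow> gp_rot n r a \<in> pverts (gen_petersen n k)"
  by (cases a) (auto simp: gen_petersen_def)

lemma gp_rot_inverse:
  assumes "a \<in> pverts (gen_petersen n k)" "r \<le> n"
  shows "gp_rot n (n - r) (gp_rot n r a) = a" "gp_rot n r (gp_rot n (n - r) a) = a"
proof -
  have "((i + r) mod n + (n - r)) mod n = i" "((i + (n - r)) mod n + r) mod n = i"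
    if "i < n" for i
    using that assms(2) mod_add_left_eq[of "i + r" n "n - r"] mod_add_left_eq[of "i + (n - r)" n r]
    by simp_all
  then show "gp_rot n (n - r) (gp_rot n r a) = a" "gp_rot n r (gp_rot n (n - r) a) = a"
    using assms(1) by (auto simp: gen_petersen_def)
qed

text \<open>Rotation commutes with the shifts by \<open>1\<close> and by \<open>k\<close> modulo
  \<open>n\<close> and respects spokes, so it preserves \<open>gp_arcs\<close> and hence also its
  converse.\<close>

lemma gp_rot_arcs:
  assumes "(a, b) \<in> parcs (gen_petersen n k)"
  shows "(gp_rot n r a, gp_rot n r b) \<in> parcs (gen_petersen n k)"
proof -
  have "(gp_rot n r a, gp_rot n r b) \<in> gp_arcs n k" if "(a, b) \<in> gp_arcs n k" for a b
  proof -
    have *: "((i + s) mod n + r) mod n = ((i + r) mod n + s) mod n" for i s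
      by (simp add: mod_simps ac_simps)
    show ?thesis
      using that * by (auto simp: gp_arcs_def image_iff simp del: add_Suc_right)
  qed
  then show ?thesis using assms by (auto simp: gen_petersen_def)
qed

lemma gp_rot_arcs_iff:
  assumes "a \<in> pverts (gen_petersen n k)" "b \<in> pverts (gen_petersen n k)" "r \<le> n"
  shows "(gp_rot n r a, gp_rot n r b) \<in> parcs (gen_petersen n k) \<longleftrightarrow> (a, b) \<in> parcs (gen_petersen n k)"
  using gp_rot_arcs gp_rot_inverse assms by metis

lemma bij_betw_gp_rot:
  assumes "r \<le> n"
  shows "bij_betw (gp_rot n r) (pverts (gen_petersen n k)) (pverts (gen_petersen n k))"
  by (rule bij_betw_byWitness[where f' = "gp_rot n (n - r)"])
    (use assms gp_rot_inverse gp_rot_in_pverts in auto)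

lemma fort_gp_rot:
  assumes "fort (gen_petersen n k) F" "r \<le> n"
  shows "fort (gen_petersen n k) (gp_rot n r ` F)"
  using assms by (intro fort_image bij_betw_gp_rot gp_rot_arcs_iff)

section \<open>Executable certificates for forts and for forcing\<close>

definition gp_fort_check :: "nat \<Rightarrow> nat \<Rightarrow> gp_vertex list \<Rightarrow> bool" where
  "gp_fort_check n k F \<longleftrightarrow> F \<noteq> [] \<and>
     list_all (\<lambda>x. case x of Outer i \<Rightarrow> i < n | Inner i \<Rightarrow> i < n) F \<and>
     list_all (\<lambda>b. List.member F b \<or>
       list_all (\<lambda>x. List.member F x \<longrightarrow> list_ex (\<lambda>y. y \<noteq> x \<and> List.member F y) (gp_nbrs n k b))
         (gp_nbrs n k b))
       (map Outer [0..<n] @ map Inner [0..<n])"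

lemma gp_fort_check_sound:
  assumes "1 < n" "k < n" "gp_fort_check n k F"
  shows "fort (gen_petersen n k) (set F)"
proof -
  have verts: "pverts (gen_petersen n k) = set (map Outer [0..<n] @ map Inner [0..<n])"
    by (auto simp: gen_petersen_def)
  have "set F \<subseteq> pverts (gen_petersen n k)"
    using assms(3) unfolding gp_fort_check_def gen_petersen_def list_all_iff
    by (fastforce split: gp_vertex.splits)
  moreover have "\<exists>y\<in>set F. y \<noteq> x \<and> (b, y) \<in> parcs (gen_petersen n k)"
    if b: "b \<in> pverts (gen_petersen n k) - set F" and x: "x \<in> set F"
      and bx: "(b, x) \<in> parcs (gen_petersen n k)" for b x
  proof -
    have arcs: "(b, y) \<in> parcs (gen_petersen n k) \<longleftrightarrow> y \<in> set (gp_nbrs n k b)" for y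
      using parcs_gen_petersen_iff assms(1,2) b by blast
    have "\<forall>x\<in>set (gp_nbrs n k b). x \<in> set F \<longrightarrow> (\<exists>y\<in>set (gp_nbrs n k b). y \<noteq> x \<and> y \<in> set F)"
      using assms(3) b unfolding gp_fort_check_def list_all_iff list_ex_iff verts List.member_iff
      by blast
    then show ?thesis using arcs bx x by blast
  qed
  ultimately show ?thesis
    using assms(3) unfolding fort_def gp_fort_check_def by auto
qed

text \<open>A pair \<open>(b, w)\<close> records that \<open>b\<close> forces \<open>w\<close>. A
  \<open>w\<close> that is already black is tolerated, since adding it again does not change the
  colouring.\<close>

fun gp_force_chain :: "nat \<Rightarrow> nat \<Rightarrow> gp_vertex list \<Rightarrow> (gp_vertex \<times> gp_vertex) list \<Rightarrow> bool" where
  "gp_force_chain n k B [] = True"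
| "gp_force_chain n k B ((b, w) # ps) \<longleftrightarrow>
     List.member B b \<and> List.member (gp_nbrs n k b) w \<and>
     list_all (\<lambda>x. x = w \<or> List.member B x) (gp_nbrs n k b) \<and>
     gp_force_chain n k (w # B) ps"

text \<open>The chain need not be replayed with \<open>force_step\<close>. If the first recorded
  \<open>w\<close> outside \<open>T\<close> existed, its \<open>b\<close> would have
  \<open>w\<close> as only white neighbour in \<open>T\<close>, so \<open>T\<close> would not be
  final.\<close>

lemma gp_force_chain_subset_final:
  assumes "1 < n" "k < n" "final_coloring (gen_petersen n k) S T"
    and "T \<subseteq> pverts (gen_petersen n k)" "set B \<subseteq> T" "gp_force_chain n k B ps"
  shows "set B \<union> snd ` set ps \<subseteq> T"
  using assms(5,6)
proof (induction ps arbitrary: B)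
  case (Cons p ps)
  let ?G = "gen_petersen n k"
  obtain b w where p: "p = (b, w)" by force
  have b: "b \<in> T" "b \<in> pverts ?G" and w: "w \<in> set (gp_nbrs n k b)"
    and nb: "\<forall>x\<in>set (gp_nbrs n k b). x = w \<or> x \<in> T"
    using Cons.prems assms(4) by (auto simp: p list_all_iff)
  have "w \<in> T"
  proof (rule ccontr)
    assume "w \<notin> T"
    then have "white_neighbors ?G T b = {w}"
      using parcs_gen_petersen_iff[OF assms(1,2) b(2)] w nb gp_nbrs_subset_pverts[OF b(2)]
      unfolding white_neighbors_def by auto
    then show False
      using assms(3) b(1) unfolding final_coloring_def force_step_def by blast
  qed
  then have "set (w # B) \<union> snd ` set ps \<subseteq> T"
    using Cons.prems by (intro Cons.IH) (auto simp: p)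
  then show ?case by (auto simp: p)
qed simp

lemma zero_forcing_set_gp_force_chain:
  assumes "1 < n" "k < n" "set B \<subseteq> pverts (gen_petersen n k)" "gp_force_chain n k B ps"
    and "pverts (gen_petersen n k) \<subseteq> set B \<union> snd ` set ps"
  shows "zero_forcing_set (gen_petersen n k) (set B)"
proof -
  let ?G = "gen_petersen n k"
  let ?T = "zf_closure ?G (set B)"
  have fin: "final_coloring ?G (set B) ?T"
    by (rule final_coloring_zf_closure[OF finite_pverts_gen_petersen])
  then have "set B \<subseteq> ?T"
    by (intro reachable_subset_final) auto
  have "(force_step ?G)\<^sup>*\<^sup>* (set B) ?T"
    using fin unfolding final_coloring_def by blast
  then have "?T \<subseteq> pverts ?G"
    by induction (use assms(3) in \<open>auto simp: force_step_def white_neighbors_def\<close>)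
  then show ?thesis
    using gp_force_chain_subset_final[OF assms(1,2) fin _ \<open>set B \<subseteq> ?T\<close> assms(4)] assms(3,5)
    unfolding zero_forcing_set_def by blast
qed

section \<open>The graph \<open>P(12,3)\<close>\<close>

definition gp_list :: "nat list \<Rightarrow> nat list \<Rightarrow> gp_vertex list" where
  "gp_list us vs = map Outer us @ map Inner vs"

text \<open>Forts disjoint from the closed neighbourhood of \<open>u_0\<close>, which is
  \<open>u_0, u_1, u_11, v_0\<close>. They are ordered by nondecreasing size, so that
  \<open>hittable\<close> always branches over a smallest fort not yet hit.\<close>

definition outer_forts :: "gp_vertex list list" where
  "outer_forts = [gp_list [2, 6, 8] [1, 3, 5, 7, 9],
    gp_list [4, 6, 10] [3, 5, 7, 9, 11],
    gp_list [5, 7, 8, 10] [4, 5, 10, 11],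
    gp_list [2, 4, 10] [1, 3, 5, 9, 11],
    gp_list [4, 6, 7, 9] [3, 4, 9, 10],
    gp_list [3, 7, 9] [2, 4, 6, 8, 10],
    gp_list [2, 8, 10] [1, 3, 7, 9, 11],
    gp_list [3, 5, 9] [2, 4, 6, 8, 10],
    gp_list [2, 4, 8, 10] [1, 5, 7, 11],
    gp_list [2, 4, 5, 7] [1, 2, 7, 8],
    gp_list [3, 5, 6, 8] [2, 3, 8, 9],
    gp_list [2, 6, 10] [1, 3, 5, 7, 9, 11],
    gp_list [2, 3, 4, 5, 9, 10] [1, 6, 8, 11],
    gp_list [2, 3, 7, 8, 9, 10] [1, 4, 6, 11],
    gp_list [3, 4, 7, 9, 10] [2, 5, 6, 7, 11],
    gp_list [2, 3, 5, 8, 9] [1, 5, 6, 7, 10]]"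

text \<open>The counterpart for \<open>v_0\<close>, with closed neighbourhood
  \<open>v_0, v_3, v_9, u_0\<close>, in the same order by size. Rotations have exactly two vertex
  orbits, outer and inner, hence two lists.\<close>

definition inner_forts :: "gp_vertex list list" where
  "inner_forts = [gp_list [3, 5, 9] [2, 4, 6, 8, 10],
    gp_list [2, 4, 8, 10] [1, 5, 7, 11],
    gp_list [5, 7, 8, 10] [4, 5, 10, 11],
    gp_list [2, 4, 5, 7] [1, 2, 7, 8],
    gp_list [1, 2, 4, 11] [4, 5, 10, 11],
    gp_list [1, 5, 7, 11] [2, 4, 8, 10],
    gp_list [3, 7, 9] [2, 4, 6, 8, 10],
    gp_list [1, 8, 10, 11] [1, 2, 7, 8],
    gp_list [1, 3, 5, 7, 9, 11] [2, 4, 6],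
    gp_list [1, 3, 5, 7, 9, 11] [6, 8, 10],
    gp_list [2, 4, 5, 7, 8, 10] [1, 2, 4, 11],
    gp_list [1, 2, 4, 5, 7, 11] [5, 7, 8, 10],
    gp_list [1, 5, 7, 8, 10, 11] [2, 4, 5, 7],
    gp_list [3, 4, 7, 9, 10] [2, 5, 6, 7, 11],
    gp_list [2, 3, 5, 8, 9] [1, 5, 6, 7, 10],
    gp_list [1, 3, 6, 7, 9, 11] [4, 5, 6, 11],
    gp_list [2, 3, 4, 5, 9, 10] [1, 6, 8, 11],
    gp_list [2, 3, 4, 7, 8, 9] [1, 5, 6, 10],
    gp_list [1, 2, 4, 5, 7, 11] [1, 8, 10, 11],
    gp_list [1, 3, 5, 8, 9, 11] [1, 6, 7, 8],
    gp_list [3, 4, 5, 8, 9, 10] [2, 6, 7, 11],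
    gp_list [2, 3, 7, 8, 9, 10] [1, 4, 6, 11]]"

lemma outer_forts_check:
  "list_all (\<lambda>F. gp_fort_check 12 3 F \<and>
     list_all (\<lambda>x. \<not> List.member F x) (Outer 0 # gp_nbrs 12 3 (Outer 0))) outer_forts"
  by code_simp

lemma inner_forts_check:
  "list_all (\<lambda>F. gp_fort_check 12 3 F \<and>
     list_all (\<lambda>x. \<not> List.member F x) (Inner 0 # gp_nbrs 12 3 (Inner 0))) inner_forts"
  by code_simp

lemma not_hittable_outer_forts: "\<not> hittable 3 outer_forts"
  by code_simp

lemma not_hittable_inner_forts: "\<not> hittable 3 inner_forts"
  by code_simp

section \<open>Lower bound\<close>

lemma distinct_gp_nbrs_12_3:
  "list_all (\<lambda>b. distinct (b # gp_nbrs 12 3 b)) (map Outer [0..<12] @ map Inner [0..<12])"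
  by code_simp

text \<open>Each listed fort, rotated by \<open>r\<close>, is a fort that \<open>S\<close> must
  meet, and it avoids the closed neighbourhood of \<open>b\<close>. Rotating the part of
  \<open>S\<close> outside that neighbourhood back by \<open>r\<close> therefore yields a
  transversal of the original list.\<close>

lemma zero_forcing_set_hittable:
  assumes rot: "gp_rot n r b0 = b" and b0: "b0 \<in> pverts (gen_petersen n k)"
    and n: "1 < n" "k < n" "r \<le> n"
    and S: "zero_forcing_set (gen_petersen n k) S"
    and few: "card (S - set (b # gp_nbrs n k b)) \<le> m"
    and forts: "list_all (\<lambda>F. gp_fort_check n k F \<and>
      list_all (\<lambda>x. \<not> List.member F x) (b0 # gp_nbrs n k b0)) Fs"
  shows "hittable m Fs"
proof (rule hittable_complete)
  let ?G = "gen_petersen n k"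
  let ?T = "gp_rot n (n - r) ` (S - set (b # gp_nbrs n k b))"
  have SV: "S \<subseteq> pverts ?G"
    using S unfolding zero_forcing_set_def by blast
  then have fin: "finite S"
    using finite_pverts_gen_petersen finite_subset by blast
  then show "finite ?T" by simp
  show "card ?T \<le> m"
    using card_image_le few fin by (meson finite_Diff order_trans)
  show "?T \<inter> set F \<noteq> {}" if F: "F \<in> set Fs" for F
  proof -
    have fort: "fort ?G (set F)"
      using forts F gp_fort_check_sound n by (auto simp: list_all_iff)
    then have FV: "set F \<subseteq> pverts ?G"
      unfolding fort_def by blast
    obtain x where x: "x \<in> set F" "gp_rot n r x \<in> S"
      using zero_forcing_set_meets_fort[OF finite_pverts_gen_petersen S fort_gp_rot[OF fort n(3)]]
      by blast
    have xV: "x \<in> pverts ?G" using x(1) FV by blast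
    have "x \<noteq> b0" "x \<notin> set (gp_nbrs n k b0)"
      using forts F x(1) by (auto simp: list_all_iff)
    \<comment> \<open>Being an automorphism that sends \<open>b0\<close> to \<open>b\<close>, the
      rotation matches the two closed neighbourhoods.\<close>
    moreover have "gp_rot n r x \<in> set (gp_nbrs n k b) \<longleftrightarrow> x \<in> set (gp_nbrs n k b0)"
      using gp_rot_arcs_iff[OF b0 xV n(3)] parcs_gen_petersen_iff[OF n(1,2)]
        gp_rot_in_pverts[OF b0] b0 rot by metis
    moreover have "gp_rot n r x = b \<longleftrightarrow> x = b0"
      using gp_rot_inverse(1)[OF xV n(3)] gp_rot_inverse(1)[OF b0 n(3)] rot by metis
    ultimately have "gp_rot n r x \<in> S - set (b # gp_nbrs n k b)"
      using x(2) by auto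
    then have "x \<in> ?T"
      using gp_rot_inverse(1)[OF xV n(3)] by (metis image_eqI)
    then show ?thesis using x(1) by blast
  qed
qed

lemma card_pverts_gen_petersen: "card (pverts (gen_petersen n k)) = 2 * n"
proof -
  have "card (Outer ` {..<n} \<union> Inner ` {..<n}) = card (Outer ` {..<n}) + card (Inner ` {..<n})"
    by (rule card_Un_disjoint) auto
  then show ?thesis
    by (simp add: gen_petersen_def card_image inj_on_def)
qed

lemma zero_forcing_set_12_3_card_ge:
  assumes S: "zero_forcing_set (gen_petersen 12 3) S"
  shows "7 \<le> card S"
proof (rule ccontr)
  let ?G = "gen_petersen 12 3"
  assume "\<not> 7 \<le> card S"
  then have card: "card S \<le> 6" by simp
  \<comment> \<open>The graph has 24 vertices, so at least one force must take place.\<close>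
  then have "S \<noteq> pverts ?G"
    using card_pverts_gen_petersen[of 12 3] by auto
  then obtain b w where b: "b \<in> S" "white_neighbors ?G S b = {w}"
    using zero_forcing_set_first_force[OF finite_pverts_gen_petersen S] by blast
  have SV: "S \<subseteq> pverts ?G"
    using S unfolding zero_forcing_set_def by blast
  then have fin: "finite S"
    using finite_pverts_gen_petersen finite_subset by blast
  have bV: "b \<in> pverts ?G" using b(1) SV by blast
  then have "distinct (b # gp_nbrs 12 3 b)"
    using distinct_gp_nbrs_12_3 unfolding list_all_iff by (auto simp: gen_petersen_def)
  moreover have "length (b # gp_nbrs 12 3 b) = 4"
    by (cases b) auto
  ultimately have "card (set (b # gp_nbrs 12 3 b)) = 4"
    using distinct_card by metis
  then have "3 \<le> card (set (b # gp_nbrs 12 3 b) - {w})"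
    using diff_card_le_card_Diff[of "{w}" "set (b # gp_nbrs 12 3 b)"] by simp
  \<comment> \<open>Before the first force, \<open>w\<close> is the only white vertex in the closed
    neighbourhood of \<open>b\<close>; the other three are black.\<close>
  also have "set (b # gp_nbrs 12 3 b) - {w} \<subseteq> S \<inter> set (b # gp_nbrs 12 3 b)"
    using b gp_nbrs_subset_pverts[OF bV] parcs_gen_petersen_iff[of 12 3, OF _ _ bV]
    unfolding white_neighbors_def by auto
  then have "card (set (b # gp_nbrs 12 3 b) - {w}) \<le> card (S \<inter> set (b # gp_nbrs 12 3 b))"
    using fin by (intro card_mono) auto
  \<comment> \<open>At most 6 black vertices, at least 3 of them in the closed neighbourhood, leave
    at most 3 outside.\<close>
  finally have few: "card (S - set (b # gp_nbrs 12 3 b)) \<le> 3"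
    using card card_Diff_subset_Int[of S "set (b # gp_nbrs 12 3 b)"] by simp
  show False
  proof (cases b)
    case (Outer r)
    then have "r < 12" using bV by (auto simp: gen_petersen_def)
    \<comment> \<open>Rotation by \<open>r\<close> takes \<open>u_0\<close> to \<open>b\<close>,
      because \<open>r < 12\<close> gives \<open>(0 + r) mod 12 = r\<close>.\<close>
    then have "hittable 3 outer_forts"
      using Outer
      by (intro zero_forcing_set_hittable[OF _ _ _ _ _ S few outer_forts_check, of r])
        (auto simp: gen_petersen_def)
    then show False using not_hittable_outer_forts by blast
  next
    case (Inner r)
    then have "r < 12" using bV by (auto simp: gen_petersen_def)
    then have "hittable 3 inner_forts"
      using Inner
      by (intro zero_forcing_set_hittable[OF _ _ _ _ _ S few inner_forts_check, of r])
        (auto simp: gen_petersen_def)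
    then show False using not_hittable_inner_forts by blast
  qed
qed

section \<open>Upper bound\<close>

lemma zero_forcing_set_12_3_outer:
  "zero_forcing_set (gen_petersen 12 3) (set (gp_list [0..<7] []))"
proof (rule zero_forcing_set_gp_force_chain)
  let ?ps = "[(Outer 1, Inner 1), (Outer 2, Inner 2), (Outer 3, Inner 3), (Outer 4, Inner 4),
      (Outer 5, Inner 5), (Inner 2, Inner 11), (Inner 1, Inner 10), (Inner 4, Inner 7),
      (Inner 5, Inner 8), (Inner 10, Outer 10), (Inner 7, Outer 7), (Inner 8, Outer 8),
      (Inner 11, Outer 11), (Outer 0, Inner 0), (Outer 6, Inner 6), (Outer 10, Outer 9),
      (Inner 0, Inner 9)]"
  show "gp_force_chain 12 3 (gp_list [0..<7] []) ?ps"
    by code_simp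
  have "list_all (\<lambda>x. List.member (gp_list [0..<7] [] @ map snd ?ps) x)
      (map Outer [0..<12] @ map Inner [0..<12])"
    by code_simp
  then show "pverts (gen_petersen 12 3) \<subseteq> set (gp_list [0..<7] []) \<union> snd ` set ?ps"
    unfolding list_all_iff Ball_def List.member_iff gen_petersen_def
    by (simp only: set_append set_map set_upt atLeast0LessThan pair_pre_digraph.simps) blast
qed (auto simp: gp_list_def gen_petersen_def)

theorem theorem1:
  shows "zero_forcing_number (gen_petersen 12 3) = 7
    \<and> zero_forcing_number (gen_petersen 12 3) \<noteq> 8
    \<and> \<not> (\<forall>n\<ge>12. zero_forcing_number (gen_petersen n 3) = 8)"
proof -
  have "card (set (gp_list [0..<7] [])) = 7"
    by (simp add: gp_list_def card_image inj_on_def)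
  then have "7 \<in> card ` {S. zero_forcing_set (gen_petersen 12 3) S}"
    using zero_forcing_set_12_3_outer by (metis image_eqI mem_Collect_eq)
  moreover have "finite (card ` {S. zero_forcing_set (gen_petersen 12 3) S})"
    by (intro finite_imageI finite_zero_forcing_sets finite_pverts_gen_petersen)
  ultimately have "zero_forcing_number (gen_petersen 12 3) = 7"
    unfolding zero_forcing_number_def
    by (intro Min_eqI) (auto dest: zero_forcing_set_12_3_card_ge)
  \<comment> \<open>The value 7 at \<open>n = 12\<close> itself refutes the universal claim.\<close>
  then show ?thesis by auto
qed

end
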